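(* Let $M \prec N$ be structures, let $G$ be a group definable over $M$, and let $X \subset G$ be a subset definable with parameters from $M$. If $X(N)$ is a J-set of $G$ in $N$, then $X(M)$ is a J-set of $G$ in $M$. Moreover, if $M$ is $\aleph_0$-saturated, the converse holds: if $X(M)$ is a J-set of $G$ in $M$, then $X(N)$ is a J-set of $G$ in $N$.
   Context: Here $\mathbb{N}=\{1,2,\dots\}$. For $m\ge 1$ let $\mathfrak{j}_m=\{s\in\mathbb{N}^m : s(1)<s(2)<\dots<s(m)\}$. For a structure $M$, a group $G$ definable over $M$, $m\ge 1$, $a\in G(M)^{m+1}$, $t\in\mathfrak{j}_m$ and $f\in G(M)^{\mathbb{N}}$, put $\chi(m,a,t,f)=a(1)f(t(1))a(2)f(t(2))\cdots a(m)f(t(m))a(m+1)$. A subset $X\subset G(M)$ is a J-set of $G$ in $M$ if for every finite $F\subset G(M)^{\mathbb{N}}$ there are $m\ge 1$, $t\in\mathfrak{j}_m$ and $a\in G(M)^{m+1}$ such that $\chi(m,a,t,f)\in X$ for every $f\in F$. $X(M)$ and $X(N)$ denote the sets of realizations in $M$ and $N$ of the formula defining $X$. *)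

theory Defs
  imports "HOL-Algebra.Group"
begin

section \<open>First-order logic\<close>

text \<open>A language is a set of function symbols and a set of relation symbols, each symbol paired
  with its arity. Constants are function symbols of arity 0.\<close>

record ('f, 'p) lang =
  fsyms :: "('f \<times> nat) set"
  rsyms :: "('p \<times> nat) set"

datatype 'f fterm = Var nat | Fn 'f "'f fterm list"

datatype ('f, 'p) form =
    Eql "'f fterm" "'f fterm"
  | Rel 'p "'f fterm list"
  | Neg "('f, 'p) form"
  | Conj "('f, 'p) form" "('f, 'p) form"
  | Exi nat "('f, 'p) form"

primrec wf_term :: "('f, 'p) lang \<Rightarrow> 'f fterm \<Rightarrow> bool" where
  "wf_term L (Var i) = True"
| "wf_term L (Fn f ts) = ((f, length ts) \<in> fsyms L \<and> (\<forall>b\<in>set (map (wf_term L) ts). b))"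

primrec wf_form :: "('f, 'p) lang \<Rightarrow> ('f, 'p) form \<Rightarrow> bool" where
  "wf_form L (Eql s t) = (wf_term L s \<and> wf_term L t)"
| "wf_form L (Rel p ts) = ((p, length ts) \<in> rsyms L \<and> (\<forall>t\<in>set ts. wf_term L t))"
| "wf_form L (Neg \<phi>) = wf_form L \<phi>"
| "wf_form L (Conj \<phi> \<psi>) = (wf_form L \<phi> \<and> wf_form L \<psi>)"
| "wf_form L (Exi i \<phi>) = wf_form L \<phi>"

primrec fv_term :: "'f fterm \<Rightarrow> nat set" where
  "fv_term (Var i) = {i}"
| "fv_term (Fn f ts) = \<Union> (set (map fv_term ts))"

primrec fv :: "('f, 'p) form \<Rightarrow> nat set" where
  "fv (Eql s t) = fv_term s \<union> fv_term t"
| "fv (Rel p ts) = (\<Union>t\<in>set ts. fv_term t)"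
| "fv (Neg \<phi>) = fv \<phi>"
| "fv (Conj \<phi> \<psi>) = fv \<phi> \<union> fv \<psi>"
| "fv (Exi i \<phi>) = fv \<phi> - {i}"

record ('f, 'p, 'a) fo_struct =
  univ :: "'a set"
  fint :: "'f \<Rightarrow> 'a list \<Rightarrow> 'a"
  rint :: "'p \<Rightarrow> 'a list \<Rightarrow> bool"

definition is_struct :: "('f, 'p) lang \<Rightarrow> ('f, 'p, 'a) fo_struct \<Rightarrow> bool" where
  "is_struct L M \<longleftrightarrow> univ M \<noteq> {} \<and>
    (\<forall>(f, n) \<in> fsyms L. \<forall>xs. length xs = n \<and> set xs \<subseteq> univ M \<longrightarrow> fint M f xs \<in> univ M)"

primrec tval :: "('f, 'p, 'a) fo_struct \<Rightarrow> (nat \<Rightarrow> 'a) \<Rightarrow> 'f fterm \<Rightarrow> 'a" where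
  "tval M e (Var i) = e i"
| "tval M e (Fn f ts) = fint M f (map (tval M e) ts)"

primrec sat :: "('f, 'p, 'a) fo_struct \<Rightarrow> (nat \<Rightarrow> 'a) \<Rightarrow> ('f, 'p) form \<Rightarrow> bool" where
  "sat M e (Eql s t) = (tval M e s = tval M e t)"
| "sat M e (Rel p ts) = rint M p (map (tval M e) ts)"
| "sat M e (Neg \<phi>) = (\<not> sat M e \<phi>)"
| "sat M e (Conj \<phi> \<psi>) = (sat M e \<phi> \<and> sat M e \<psi>)"
| "sat M e (Exi i \<phi>) = (\<exists>a\<in>univ M. sat M (e(i := a)) \<phi>)"

definition substruct ::
  "('f, 'p) lang \<Rightarrow> ('f, 'p, 'a) fo_struct \<Rightarrow> ('f, 'p, 'a) fo_struct \<Rightarrow> bool" where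
  "substruct L M N \<longleftrightarrow> is_struct L M \<and> is_struct L N \<and> univ M \<subseteq> univ N \<and>
    (\<forall>(f, n) \<in> fsyms L. \<forall>xs. length xs = n \<and> set xs \<subseteq> univ M \<longrightarrow> fint M f xs = fint N f xs) \<and>
    (\<forall>(p, n) \<in> rsyms L. \<forall>xs. length xs = n \<and> set xs \<subseteq> univ M \<longrightarrow> rint M p xs = rint N p xs)"

definition elem_substruct ::
  "('f, 'p) lang \<Rightarrow> ('f, 'p, 'a) fo_struct \<Rightarrow> ('f, 'p, 'a) fo_struct \<Rightarrow> bool" where
  "elem_substruct L M N \<longleftrightarrow> substruct L M N \<and>
    (\<forall>\<phi> e. wf_form L \<phi> \<and> range e \<subseteq> univ M \<longrightarrow> (sat M e \<phi> \<longleftrightarrow> sat N e \<phi>))"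


section \<open>Definable sets and saturation\<close>

text \<open>A formula with parameters in \<open>n\<close> free variables is a formula \<open>\<phi>\<close> together with a finite list
  \<open>ps\<close>: the variables \<open>0, \<dots>, n - 1\<close> are the free ones, and variable \<open>n + i\<close> stands for the
  parameter \<open>ps ! i\<close>.\<close>

definition param_form ::
  "('f, 'p) lang \<Rightarrow> ('f, 'p, 'a) fo_struct \<Rightarrow> nat \<Rightarrow> ('f, 'p) form \<Rightarrow> 'a list \<Rightarrow> bool" where
  "param_form L M n \<phi> ps \<longleftrightarrow> wf_form L \<phi> \<and> fv \<phi> \<subseteq> {..<n + length ps} \<and> set ps \<subseteq> univ M"

definition realizations ::
  "('f, 'p, 'a) fo_struct \<Rightarrow> nat \<Rightarrow> ('f, 'p) form \<Rightarrow> 'a list \<Rightarrow> 'a list set" where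
  "realizations M n \<phi> ps =
    {xs. length xs = n \<and> set xs \<subseteq> univ M \<and> sat M (\<lambda>i. (xs @ ps) ! i) \<phi>}"

text \<open>Every finitely satisfiable set of formulas in one free variable over finitely many
  parameters is realized.\<close>

definition aleph0_saturated :: "('f, 'p) lang \<Rightarrow> ('f, 'p, 'a) fo_struct \<Rightarrow> bool" where
  "aleph0_saturated L M \<longleftrightarrow>
    (\<forall>ps \<Phi>. (\<forall>\<phi>\<in>\<Phi>. param_form L M 1 \<phi> ps) \<and>
       (\<forall>\<Phi>0. finite \<Phi>0 \<and> \<Phi>0 \<subseteq> \<Phi> \<longrightarrow> (\<exists>a\<in>univ M. \<forall>\<phi>\<in>\<Phi>0. [a] \<in> realizations M 1 \<phi> ps)) \<longrightarrow>
       (\<exists>a\<in>univ M. \<forall>\<phi>\<in>\<Phi>. [a] \<in> realizations M 1 \<phi> ps))"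


section \<open>Definable groups\<close>

text \<open>A definable group is given by a formula \<open>\<gamma>\<close> for its underlying set of \<open>k\<close>-tuples and a
  formula \<open>\<mu>\<close> for the graph of its multiplication, both with parameters \<open>ps\<close>. Evaluating the two
  formulas in \<open>M\<close> gives \<open>G(M)\<close>, in an elementary extension \<open>N\<close> it gives \<open>G(N)\<close>.\<close>

definition group_points ::
  "('f, 'p, 'a) fo_struct \<Rightarrow> nat \<Rightarrow> ('f, 'p) form \<Rightarrow> ('f, 'p) form \<Rightarrow> 'a list \<Rightarrow> 'a list monoid" where
  "group_points M k \<gamma> \<mu> ps =
    \<lparr>carrier = realizations M k \<gamma> ps,
     mult = (\<lambda>x y. THE z. x @ y @ z \<in> realizations M (3 * k) \<mu> ps),
     one = (THE e. e \<in> realizations M k \<gamma> ps \<and>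
              (\<forall>x\<in>realizations M k \<gamma> ps. e @ x @ x \<in> realizations M (3 * k) \<mu> ps))\<rparr>"

definition definable_group ::
  "('f, 'p) lang \<Rightarrow> ('f, 'p, 'a) fo_struct \<Rightarrow> nat \<Rightarrow> ('f, 'p) form \<Rightarrow> ('f, 'p) form \<Rightarrow> 'a list \<Rightarrow> bool" where
  "definable_group L M k \<gamma> \<mu> ps \<longleftrightarrow>
    param_form L M k \<gamma> ps \<and> param_form L M (3 * k) \<mu> ps \<and>
    group (group_points M k \<gamma> \<mu> ps) \<and>
    realizations M (3 * k) \<mu> ps =
      {x @ y @ (x \<otimes>\<^bsub>group_points M k \<gamma> \<mu> ps\<^esub> y) | x y.
         x \<in> carrier (group_points M k \<gamma> \<mu> ps) \<and> y \<in> carrier (group_points M k \<gamma> \<mu> ps)}"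


section \<open>J-sets\<close>

text \<open>All sequences are indexed from 1.\<close>

definition incr_seqs :: "nat \<Rightarrow> (nat \<Rightarrow> nat) set" where
  "incr_seqs m = {s \<in> {1..m} \<rightarrow>\<^sub>E {1..}. strict_mono_on {1..m} s}"

primrec chi :: "('g, 'b) monoid_scheme \<Rightarrow> nat \<Rightarrow> (nat \<Rightarrow> 'g) \<Rightarrow> (nat \<Rightarrow> nat) \<Rightarrow> (nat \<Rightarrow> 'g) \<Rightarrow> 'g" where
  "chi G 0 a t f = a 1"
| "chi G (Suc m) a t f = chi G m a t f \<otimes>\<^bsub>G\<^esub> f (t (m + 1)) \<otimes>\<^bsub>G\<^esub> a (m + 2)"

definition J_set :: "('g, 'b) monoid_scheme \<Rightarrow> 'g set \<Rightarrow> bool" where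
  "J_set G X \<longleftrightarrow> X \<subseteq> carrier G \<and>
    (\<forall>F. finite F \<and> F \<subseteq> ({1..} \<rightarrow>\<^sub>E carrier G) \<longrightarrow>
      (\<exists>m\<ge>1. \<exists>t\<in>incr_seqs m. \<exists>a \<in> {1..m + 1} \<rightarrow>\<^sub>E carrier G. \<forall>f\<in>F. chi G m a t f \<in> X))"

end

theory Submission
  imports Defs "HOL-Library.Nat_Bijection"
begin

text \<open>For finitely many sequences \<open>f\<^sub>0, \<dots>, f\<^sub>r\<^sub>-\<^sub>1\<close> in \<open>G\<close> and for fixed \<open>m\<close> and \<open>t\<close>, the statement
  ``some \<open>a\<close> puts \<open>\<chi>(m, a, t, f\<^sub>j)\<close> into \<open>X\<close> for all \<open>j < r\<close>'' is a first-order formula \<open>\<theta>\<^sub>m\<^sub>,\<^sub>t\<close> about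
  the finitely many tuples \<open>f\<^sub>j(t(i))\<close>. Thus \<open>X\<close> is a J-set exactly if every \<open>r\<close> and every choice of
  sequences satisfy one of the countably many formulas \<open>\<theta>\<^sub>m\<^sub>,\<^sub>t\<close>.

  Sequences in \<open>G(M)\<close> are sequences in \<open>G(N)\<close>, and \<open>\<theta>\<^sub>m\<^sub>,\<^sub>t\<close> has the same truth value for them in \<open>M\<close>
  and in \<open>N\<close>. This gives the descent from \<open>N\<close> to \<open>M\<close> (\<open>J_set_descends\<close>).

  For the converse let sequences in \<open>G(N)\<close> be given. Their coordinates form one countable sequence
  of elements of \<open>N\<close>. If \<open>M\<close> is \<open>\<aleph>\<^sub>0\<close>-saturated, then some sequence in \<open>M\<close> has the same type over
  the parameters: its entries are found one after the other, each realizing a type over the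
  parameters and the earlier entries (\<open>saturated_realizes_sequence\<close>). Read as sequences
  in \<open>G(M)\<close> they satisfy some \<open>\<theta>\<^sub>m\<^sub>,\<^sub>t\<close> because \<open>X(M)\<close> is a J-set, and by equality of types the given
  sequences satisfy the same \<open>\<theta>\<^sub>m\<^sub>,\<^sub>t\<close> (\<open>J_set_ascends\<close>).

  To avoid writing out the formulas \<open>\<theta>\<^sub>m\<^sub>,\<^sub>t\<close>, the proof works with predicates on \<open>k\<close>-tuples that are
  defined by a common formula in \<open>M\<close> and in \<open>N\<close>. They are called uniform below. Uniform predicates
  are closed under the logical operations, so that \<open>uniform_solvable\<close> follows from
  the shape of \<open>\<theta>\<^sub>m\<^sub>,\<^sub>t\<close>. The multiplication enters through its graph, and by transfer the graph is
  that of an operation on \<open>G(N)\<close> as well (\<open>graph_iff_mult\<close>).\<close>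

section \<open>Formulas and assignments\<close>

lemma finite_fv_term: "finite (fv_term t)"
  by (induction t) auto

lemma finite_fv: "finite (fv \<phi>)"
  by (induction \<phi>) (auto simp: finite_fv_term)

lemma tval_cong: "(\<And>i. i \<in> fv_term t \<Longrightarrow> e i = e' i) \<Longrightarrow> tval S e t = tval S e' t"
proof (induction t)
  case (Fn f ts)
  then have "map (tval S e) ts = map (tval S e') ts" by auto
  then show ?case by (simp only: tval.simps)
qed simp

lemma sat_cong: "(\<And>i. i \<in> fv \<phi> \<Longrightarrow> e i = e' i) \<Longrightarrow> sat S e \<phi> \<longleftrightarrow> sat S e' \<phi>"
proof (induction \<phi> arbitrary: e e')
  case (Eql s t)
  then show ?case using tval_cong[of s e e' S] tval_cong[of t e e' S] by simp
next
  case (Rel p ts)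
  then have "map (tval S e) ts = map (tval S e') ts"
    by (auto intro!: tval_cong)
  then show ?case by (simp only: sat.simps)
next
  case (Neg \<phi>)
  from Neg.IH[of e e'] Neg.prems show ?case by simp
next
  case (Conj \<phi> \<psi>)
  have "sat S e \<phi> = sat S e' \<phi>" "sat S e \<psi> = sat S e' \<psi>"
    by (rule Conj.IH; use Conj.prems in auto)+
  then show ?case by simp
next
  case (Exi i \<phi>)
  have "sat S (e(i := a)) \<phi> = sat S (e'(i := a)) \<phi>" for a
    by (rule Exi.IH) (use Exi.prems in auto)
  then show ?case by (simp only: sat.simps)
qed

primrec ren_term :: "(nat \<Rightarrow> nat) \<Rightarrow> 'f fterm \<Rightarrow> 'f fterm" where
  "ren_term \<sigma> (Var i) = Var (\<sigma> i)"
| "ren_term \<sigma> (Fn f ts) = Fn f (map (ren_term \<sigma>) ts)"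

text \<open>Substitution of variables for the free variables. The map \<open>\<sigma>\<close> may identify variables, so a
  bound variable is replaced by one outside \<open>\<sigma> ` fv \<phi>\<close> to avoid capture.\<close>

primrec ren :: "(nat \<Rightarrow> nat) \<Rightarrow> ('f, 'p) form \<Rightarrow> ('f, 'p) form" where
  "ren \<sigma> (Eql s t) = Eql (ren_term \<sigma> s) (ren_term \<sigma> t)"
| "ren \<sigma> (Rel p ts) = Rel p (map (ren_term \<sigma>) ts)"
| "ren \<sigma> (Neg \<phi>) = Neg (ren \<sigma> \<phi>)"
| "ren \<sigma> (Conj \<phi> \<psi>) = Conj (ren \<sigma> \<phi>) (ren \<sigma> \<psi>)"
| "ren \<sigma> (Exi i \<phi>) = (let j = (SOME j. j \<notin> \<sigma> ` fv \<phi>) in Exi j (ren (\<sigma>(i := j)) \<phi>))"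

lemma fresh_exists: "(SOME j. j \<notin> \<sigma> ` fv \<phi>) \<notin> \<sigma> ` fv \<phi>" for \<sigma> :: "nat \<Rightarrow> nat"
  by (rule someI_ex) (use finite_fv ex_new_if_finite[of "\<sigma> ` fv \<phi>"] in auto)

lemma tval_ren_term: "tval S e (ren_term \<sigma> t) = tval S (e \<circ> \<sigma>) t"
proof (induction t)
  case (Fn f ts)
  then have "map (tval S e) (map (ren_term \<sigma>) ts) = map (tval S (e \<circ> \<sigma>)) ts"
    unfolding map_map by (intro map_cong refl trans[OF comp_apply] Fn.IH)
  then show ?case by (simp only: tval.simps ren_term.simps)
qed simp

lemma wf_ren_term: "wf_term L t \<Longrightarrow> wf_term L (ren_term \<sigma> t)"
  by (induction t) auto

lemma fv_ren_term: "fv_term (ren_term \<sigma> t) = \<sigma> ` fv_term t"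
  by (induction t) auto

lemma sat_ren: "sat S e (ren \<sigma> \<phi>) \<longleftrightarrow> sat S (e \<circ> \<sigma>) \<phi>"
proof (induction \<phi> arbitrary: e \<sigma>)
  case (Rel p ts)
  have "map (tval S e) (map (ren_term \<sigma>) ts) = map (tval S (e \<circ> \<sigma>)) ts"
    by (simp add: tval_ren_term)
  then show ?case by (simp only: sat.simps ren.simps)
next
  case (Exi i \<phi>)
  define j where "j = (SOME j. j \<notin> \<sigma> ` fv \<phi>)"
  have "j \<notin> \<sigma> ` fv \<phi>" unfolding j_def by (rule fresh_exists)
  then have "sat S (e(j := a) \<circ> \<sigma>(i := j)) \<phi> = sat S ((e \<circ> \<sigma>)(i := a)) \<phi>" for a
    by (intro sat_cong) auto
  moreover have "ren \<sigma> (Exi i \<phi>) = Exi j (ren (\<sigma>(i := j)) \<phi>)" by (simp add: Let_def j_def)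
  ultimately show ?case by (simp only: sat.simps Exi.IH)
qed (simp_all add: tval_ren_term)

lemma wf_ren: "wf_form L \<phi> \<Longrightarrow> wf_form L (ren \<sigma> \<phi>)"
  by (induction \<phi> arbitrary: \<sigma>) (auto simp: wf_ren_term Let_def)

lemma fv_ren: "fv (ren \<sigma> \<phi>) \<subseteq> \<sigma> ` fv \<phi>"
proof (induction \<phi> arbitrary: \<sigma>)
  case (Conj \<phi> \<psi>)
  from Conj.IH(1)[of \<sigma>] Conj.IH(2)[of \<sigma>] show ?case by auto
next
  case (Exi i \<phi>)
  define j where "j = (SOME j. j \<notin> \<sigma> ` fv \<phi>)"
  have "fv (ren \<sigma> (Exi i \<phi>)) = fv (ren (\<sigma>(i := j)) \<phi>) - {j}" by (simp add: Let_def j_def)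
  also have "\<dots> \<subseteq> (\<sigma>(i := j)) ` fv \<phi> - {j}" using Exi.IH[of "\<sigma>(i := j)"] by blast
  also have "\<dots> \<subseteq> \<sigma> ` fv (Exi i \<phi>)" by (auto split: if_splits)
  finally show ?case .
qed (auto simp: fv_ren_term)

text \<open>The empty conjunction needs a true sentence. The one used here has no free variables, so
  that the conjunction does not acquire new ones.\<close>

lemma finite_conjunction:
  fixes \<Phi> :: "('f, 'p) form set"
  assumes "finite \<Phi>" "\<And>\<phi>. \<phi> \<in> \<Phi> \<Longrightarrow> wf_form L \<phi>"
  shows "\<exists>\<psi>. wf_form L \<psi> \<and> fv \<psi> \<subseteq> (\<Union>\<phi>\<in>\<Phi>. fv \<phi>) \<and>
    (\<forall>S :: ('f, 'p, 'a) fo_struct. \<forall>e. sat S e \<psi> \<longleftrightarrow> (\<forall>\<phi>\<in>\<Phi>. sat S e \<phi>))"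
  using assms
proof (induction \<Phi> rule: finite_induct)
  case empty
  show ?case by (rule exI[of _ "Neg (Exi 0 (Neg (Eql (Var 0) (Var 0))))"]) simp
next
  case (insert \<phi> \<Phi>)
  then obtain \<psi> where "wf_form L \<psi>" "fv \<psi> \<subseteq> (\<Union>\<phi>\<in>\<Phi>. fv \<phi>)"
    "\<forall>S :: ('f, 'p, 'a) fo_struct. \<forall>e. sat S e \<psi> \<longleftrightarrow> (\<forall>\<phi>\<in>\<Phi>. sat S e \<phi>)"
    by auto
  with insert.prems show ?case by (intro exI[of _ "Conj \<phi> \<psi>"]) auto
qed

text \<open>A whole block of variables can be quantified at once: the new assignment may differ from the
  old one anywhere on \<open>V\<close>.\<close>

lemma finite_exists:
  fixes \<phi> :: "('f, 'p) form"
  assumes "finite V" "wf_form L \<phi>"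
  shows "\<exists>\<psi>. wf_form L \<psi> \<and> (\<forall>S :: ('f, 'p, 'a) fo_struct. \<forall>e. range e \<subseteq> univ S \<longrightarrow>
    (sat S e \<psi> \<longleftrightarrow> (\<exists>e'. range e' \<subseteq> univ S \<and> (\<forall>v. v \<notin> V \<longrightarrow> e' v = e v) \<and> sat S e' \<phi>)))"
  using assms(1)
proof (induction V rule: finite_induct)
  case empty
  have "(\<exists>e'. range e' \<subseteq> univ S \<and> (\<forall>v. e' v = e v) \<and> sat S e' \<phi>) \<longleftrightarrow> sat S e \<phi>"
    if "range e \<subseteq> univ S" for S :: "('f, 'p, 'a) fo_struct" and e
    using that by (metis ext)
  with assms(2) show ?case by (intro exI[of _ \<phi>]) simp
next
  case (insert v V)
  then obtain \<psi> where \<psi>: "wf_form L \<psi>"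
    "\<And>S :: ('f, 'p, 'a) fo_struct. \<And>e. range e \<subseteq> univ S \<Longrightarrow>
      sat S e \<psi> \<longleftrightarrow> (\<exists>e'. range e' \<subseteq> univ S \<and> (\<forall>v. v \<notin> V \<longrightarrow> e' v = e v) \<and> sat S e' \<phi>)"
    by auto
  have "sat S e (Exi v \<psi>) \<longleftrightarrow>
      (\<exists>e'. range e' \<subseteq> univ S \<and> (\<forall>w. w \<notin> insert v V \<longrightarrow> e' w = e w) \<and> sat S e' \<phi>)"
    if e: "range e \<subseteq> univ S" for S :: "('f, 'p, 'a) fo_struct" and e
  proof
    assume "sat S e (Exi v \<psi>)"
    then obtain a where a: "a \<in> univ S" "sat S (e(v := a)) \<psi>" by auto
    then have "range (e(v := a)) \<subseteq> univ S" using e by auto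
    with a \<psi>(2) obtain e' where "range e' \<subseteq> univ S" "\<forall>w. w \<notin> V \<longrightarrow> e' w = (e(v := a)) w" "sat S e' \<phi>"
      by blast
    then show "\<exists>e'. range e' \<subseteq> univ S \<and> (\<forall>w. w \<notin> insert v V \<longrightarrow> e' w = e w) \<and> sat S e' \<phi>"
      by (intro exI[of _ e']) auto
  next
    assume "\<exists>e'. range e' \<subseteq> univ S \<and> (\<forall>w. w \<notin> insert v V \<longrightarrow> e' w = e w) \<and> sat S e' \<phi>"
    then obtain e' where e': "range e' \<subseteq> univ S" "\<forall>w. w \<notin> insert v V \<longrightarrow> e' w = e w" "sat S e' \<phi>"
      by blast
    then have "range (e(v := e' v)) \<subseteq> univ S" "\<forall>w. w \<notin> V \<longrightarrow> e' w = (e(v := e' v)) w"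
      using e by auto
    then have "sat S (e(v := e' v)) \<psi>" using \<psi>(2) e' by blast
    then show "sat S e (Exi v \<psi>)" using e' by auto
  qed
  with \<psi>(1) show ?case by (intro exI[of _ "Exi v \<psi>"]) simp
qed

section \<open>Realizing types of countable sequences\<close>


text \<open>Saturation speaks of the variable \<open>0\<close> and of a list of parameters. Here the formulas may use
  any variable \<open>n\<close> as the unknown, and the parameters are the values of the other variables below
  \<open>m\<close>. The map \<open>\<sigma>\<close> in the proof translates between the two conventions.\<close>

lemma saturated_assignment:
  assumes sat: "aleph0_saturated L M"
    and e: "range e \<subseteq> univ M"
    and \<Phi>: "\<And>\<phi>. \<phi> \<in> \<Phi> \<Longrightarrow> wf_form L \<phi> \<and> fv \<phi> \<subseteq> {..<m}"
    and fin: "\<And>\<Phi>0. finite \<Phi>0 \<Longrightarrow> \<Phi>0 \<subseteq> \<Phi> \<Longrightarrow> \<exists>a\<in>univ M. \<forall>\<phi>\<in>\<Phi>0. sat M (e(n := a)) \<phi>"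
  shows "\<exists>a\<in>univ M. \<forall>\<phi>\<in>\<Phi>. sat M (e(n := a)) \<phi>"
proof -
  define \<sigma> where "\<sigma> i = (if i = n then 0 else Suc i)" for i
  define rs where "rs = map e [0..<m]"
  have real: "[a] \<in> realizations M 1 (ren \<sigma> \<phi>) rs \<longleftrightarrow> sat M (e(n := a)) \<phi>"
    if "\<phi> \<in> \<Phi>" "a \<in> univ M" for \<phi> a
  proof -
    have "sat M ((\<lambda>i. ([a] @ rs) ! i) \<circ> \<sigma>) \<phi> \<longleftrightarrow> sat M (e(n := a)) \<phi>"
      by (rule sat_cong) (use \<Phi>[OF that(1)] in \<open>auto simp: \<sigma>_def rs_def\<close>)
    then show ?thesis using that(2) by (simp add: realizations_def sat_ren)
  qed
  have "param_form L M 1 (ren \<sigma> \<phi>) rs" if "\<phi> \<in> \<Phi>" for \<phi>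
    using \<Phi>[OF that] fv_ren[of \<sigma> \<phi>] e
    by (fastforce simp: param_form_def wf_ren rs_def \<sigma>_def split: if_splits)
  moreover have "\<exists>a\<in>univ M. \<forall>\<psi>\<in>\<Psi>. [a] \<in> realizations M 1 \<psi> rs"
    if "finite \<Psi>" "\<Psi> \<subseteq> ren \<sigma> ` \<Phi>" for \<Psi>
  proof -
    from finite_subset_image[OF that] obtain \<Phi>0 where "\<Phi>0 \<subseteq> \<Phi>" "finite \<Phi>0" "\<Psi> = ren \<sigma> ` \<Phi>0"
      by auto
    moreover from this fin obtain a where "a \<in> univ M" "\<forall>\<phi>\<in>\<Phi>0. sat M (e(n := a)) \<phi>" by blast
    ultimately show ?thesis using real by (intro bexI[of _ a]) auto
  qed
  ultimately have "\<exists>a\<in>univ M. \<forall>\<psi>\<in>ren \<sigma> ` \<Phi>. [a] \<in> realizations M 1 \<psi> rs"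
    by (intro sat[unfolded aleph0_saturated_def, rule_format]) blast
  with real show ?thesis by auto
qed

definition same_type ::
  "('f, 'p) lang \<Rightarrow> ('f, 'p, 'a) fo_struct \<Rightarrow> ('f, 'p, 'a) fo_struct \<Rightarrow> nat set \<Rightarrow>
   (nat \<Rightarrow> 'a) \<Rightarrow> (nat \<Rightarrow> 'a) \<Rightarrow> bool" where
  "same_type L M N V b c \<longleftrightarrow>
    (\<forall>\<phi>. wf_form L \<phi> \<and> fv \<phi> \<subseteq> V \<longrightarrow> (sat M b \<phi> \<longleftrightarrow> sat N c \<phi>))"

text \<open>The forth step of a back-and-forth argument. The formulas that \<open>c\<close> satisfies in \<open>N\<close> form a type over the
  values of \<open>b\<close>. It is finitely satisfiable in \<open>M\<close>: for a finite conjunction \<open>\<psi>\<close>, the formula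
  \<open>\<exists>x\<^sub>n. \<psi>\<close> has only variables below \<open>n\<close>, on which \<open>b\<close> and \<open>c\<close> have the same type.\<close>

lemma same_type_extend:
  assumes sat: "aleph0_saturated L M"
    and b: "range b \<subseteq> univ M" and c: "range c \<subseteq> univ N"
    and st: "same_type L M N {..<n} b c"
  shows "\<exists>a\<in>univ M. same_type L M N {..<Suc n} (b(n := a)) c"
proof -
  define \<Phi> where "\<Phi> = {\<phi>. wf_form L \<phi> \<and> fv \<phi> \<subseteq> {..<Suc n} \<and> sat N c \<phi>}"
  have "\<exists>a\<in>univ M. \<forall>\<phi>\<in>\<Phi>. sat M (b(n := a)) \<phi>"
  proof (rule saturated_assignment[OF sat b, where m = "Suc n"])
    fix \<Phi>0 assume \<Phi>0: "finite \<Phi>0" "\<Phi>0 \<subseteq> \<Phi>"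
    then obtain \<psi> where \<psi>: "wf_form L \<psi>" "fv \<psi> \<subseteq> (\<Union>\<phi>\<in>\<Phi>0. fv \<phi>)"
      "\<And>S :: ('a, 'b, 'c) fo_struct. \<And>e. sat S e \<psi> \<longleftrightarrow> (\<forall>\<phi>\<in>\<Phi>0. sat S e \<phi>)"
      using finite_conjunction[of \<Phi>0 L] unfolding \<Phi>_def by blast
    have "sat N (c(n := c n)) \<psi>" using \<psi>(3) \<Phi>0(2) by (auto simp: \<Phi>_def)
    then have "sat N c (Exi n \<psi>)" using c by (simp only: sat.simps) blast
    moreover have "fv \<psi> \<subseteq> {..<Suc n}" using \<psi>(2) \<Phi>0(2) unfolding \<Phi>_def by blast
    then have "fv (Exi n \<psi>) \<subseteq> {..<n}" by (auto simp: less_Suc_eq)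
    ultimately have "sat M b (Exi n \<psi>)"
      using st \<psi>(1) unfolding same_type_def by (metis wf_form.simps(5))
    then show "\<exists>a\<in>univ M. \<forall>\<phi>\<in>\<Phi>0. sat M (b(n := a)) \<phi>" using \<psi>(3) by simp
  qed (auto simp: \<Phi>_def)
  then obtain a where a: "a \<in> univ M" "\<forall>\<phi>\<in>\<Phi>. sat M (b(n := a)) \<phi>" by blast
  have "sat M (b(n := a)) \<phi> \<longleftrightarrow> sat N c \<phi>" if "wf_form L \<phi>" "fv \<phi> \<subseteq> {..<Suc n}" for \<phi>
  proof (cases "sat N c \<phi>")
    case True
    then show ?thesis using a that by (auto simp: \<Phi>_def)
  next
    case False
    \<comment> \<open>\<open>\<Phi>\<close> is a complete type, so it decides \<open>\<phi>\<close> negatively.\<close>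
    then have "Neg \<phi> \<in> \<Phi>" using that by (auto simp: \<Phi>_def)
    then show ?thesis using a False by auto
  qed
  with a show ?thesis unfolding same_type_def by blast
qed

text \<open>Iterating the extension step changes one variable at a time, so the assignments converge
  pointwise. A formula has finitely many free variables, and on these the limit agrees with some
  stage. The first \<open>l\<close> entries are the parameters. They lie in \<open>M\<close>, and on them elementarity
  starts the construction.\<close>

lemma saturated_realizes_sequence:
  assumes elem: "elem_substruct L M N" and sat: "aleph0_saturated L M"
    and c: "range c \<subseteq> univ N" and cM: "\<And>i. i < l \<Longrightarrow> c i \<in> univ M"
  shows "\<exists>b. range b \<subseteq> univ M \<and> (\<forall>i<l. b i = c i) \<and> same_type L M N UNIV b c"
proof -
  have ne: "univ M \<noteq> {}" "univ M \<subseteq> univ N"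
    using elem by (auto simp: elem_substruct_def substruct_def is_struct_def)
  then obtain d where d: "d \<in> univ M" by blast
  define P where "P n b \<longleftrightarrow> range b \<subseteq> univ M \<and> same_type L M N {..<l + n} b c" for n b
  define b0 where "b0 i = (if i < l then c i else d)" for i
  have b0: "range b0 \<subseteq> univ M" using d cM by (auto simp: b0_def)
  have "sat M b0 \<phi> \<longleftrightarrow> sat N c \<phi>" if "wf_form L \<phi>" "fv \<phi> \<subseteq> {..<l}" for \<phi>
  proof -
    have "sat M b0 \<phi> \<longleftrightarrow> sat N b0 \<phi>" using elem that(1) b0 by (auto simp: elem_substruct_def)
    also have "\<dots> \<longleftrightarrow> sat N c \<phi>" by (rule sat_cong) (use that(2) in \<open>auto simp: b0_def\<close>)
    finally show ?thesis .
  qed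
  then have P0: "P 0 b0" using b0 by (auto simp: P_def same_type_def)
  have step: "\<exists>b'. P (Suc n) b' \<and> (\<forall>i<l + n. b' i = b i)" if "P n b" for n b
  proof -
    from that same_type_extend[OF sat _ c, of b "l + n"] obtain a
      where "a \<in> univ M" "same_type L M N {..<Suc (l + n)} (b(l + n := a)) c"
      by (auto simp: P_def)
    then show ?thesis using that by (intro exI[of _ "b(l + n := a)"]) (auto simp: P_def)
  qed
  define B where "B = rec_nat b0 (\<lambda>n b. SOME b'. P (Suc n) b' \<and> (\<forall>i<l + n. b' i = b i))"
  have B_step: "P (Suc n) (B (Suc n)) \<and> (\<forall>i<l + n. B (Suc n) i = B n i)" if "P n (B n)" for n
    using someI_ex[OF step[OF that]] by (simp add: B_def)
  have PB: "P n (B n)" for n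
    by (induction n) (use P0 B_step in \<open>auto simp: B_def\<close>)
  have B: "B 0 = b0" "P n (B n)" "i < l + n \<Longrightarrow> B (Suc n) i = B n i" for n i
    using PB B_step by (auto simp: B_def)
  have stable: "B n' i = B n i" if "n \<le> n'" "i < l + n" for n n' i
    using that by (induction rule: dec_induct) (simp_all add: B(3))
  define b where "b i = B (Suc i) i" for i
  have bB: "b i = B n i" if "i < l + n" for i n
  proof (cases "n \<le> Suc i")
    case True
    then show ?thesis using stable[of n "Suc i" i] that by (simp add: b_def)
  next
    case False
    then show ?thesis using stable[of "Suc i" n i] that by (simp add: b_def)
  qed
  have "range b \<subseteq> univ M" using B(2) by (auto simp: b_def P_def)
  moreover have "b i = c i" if "i < l" for i
    using bB[of i 0] that B(1) by (simp add: b0_def)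
  moreover have "sat M b \<phi> \<longleftrightarrow> sat N c \<phi>" if "wf_form L \<phi>" for \<phi>
  proof -
    obtain n where "fv \<phi> \<subseteq> {..<n}" using finite_fv[of \<phi>] by (auto simp: finite_nat_set_iff_bounded)
    then have n: "fv \<phi> \<subseteq> {..<l + n}" by auto
    then have "sat M b \<phi> \<longleftrightarrow> sat M (B n) \<phi>" by (intro sat_cong bB) auto
    also have "\<dots> \<longleftrightarrow> sat N c \<phi>" using B(2)[of n] that n by (auto simp: P_def same_type_def)
    finally show ?thesis .
  qed
  ultimately show ?thesis by (auto simp: same_type_def)
qed


section \<open>Predicates defined by one formula in both structures\<close>

locale elementary_pair =
  fixes L :: "('f, 'p) lang" and M N :: "('f, 'p, 'a) fo_struct" and k :: nat and rs :: "'a list"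
  assumes elem: "elem_substruct L M N"
    and params: "set rs \<subseteq> univ M"
begin

text \<open>The variables are divided as follows: those below \<open>length rs\<close> hold the parameters, and after
  them comes one block of \<open>k\<close> variables for each \<open>i\<close>, called its slot, which holds a \<open>k\<close>-tuple. An
  environment with the parameters in place thus amounts to a sequence of \<open>k\<close>-tuples. For \<open>k = 0\<close> the slots are
  empty.\<close>

definition tuples :: "('f, 'p, 'a) fo_struct \<Rightarrow> 'a list set" where
  "tuples S = {x. length x = k \<and> set x \<subseteq> univ S}"

definition assignments :: "('f, 'p, 'a) fo_struct \<Rightarrow> (nat \<Rightarrow> 'a list) set" where
  "assignments S = {\<rho>. \<forall>i. \<rho> i \<in> tuples S}"

definition envs :: "('f, 'p, 'a) fo_struct \<Rightarrow> (nat \<Rightarrow> 'a) set" where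
  "envs S = {e. range e \<subseteq> univ S \<and> (\<forall>i<length rs. e i = rs ! i)}"

definition slot :: "nat \<Rightarrow> nat list" where
  "slot i = [length rs + i * k..<length rs + i * k + k]"

definition blocks :: "(nat \<Rightarrow> 'a) \<Rightarrow> nat \<Rightarrow> 'a list" where
  "blocks e i = map e (slot i)"

text \<open>One formula has to serve both structures. This is what makes a predicate transferable
  between \<open>M\<close> and \<open>N\<close>.\<close>

definition uniform :: "(('f, 'p, 'a) fo_struct \<Rightarrow> (nat \<Rightarrow> 'a list) \<Rightarrow> bool) \<Rightarrow> bool" where
  "uniform P \<longleftrightarrow> (\<exists>\<phi>. wf_form L \<phi> \<and>
     (\<forall>S\<in>{M, N}. \<forall>e\<in>envs S. sat S e \<phi> \<longleftrightarrow> P S (blocks e)))"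

lemma univ_facts: "univ M \<noteq> {}" "univ M \<subseteq> univ N"
  using elem by (auto simp: elem_substruct_def substruct_def is_struct_def)

lemma tuples_mono: "tuples M \<subseteq> tuples N"
  using univ_facts by (auto simp: tuples_def)

lemma assignments_mono: "assignments M \<subseteq> assignments N"
  using tuples_mono by (auto simp: assignments_def)

lemma blocks_assignment: "e \<in> envs S \<Longrightarrow> blocks e \<in> assignments S"
  by (auto simp: envs_def assignments_def tuples_def blocks_def slot_def)

lemma slot_index:
  assumes "v \<in> set (slot i)"
  shows "(v - length rs) div k = i" "(v - length rs) mod k = v - length rs - i * k"
    "0 < k" "length rs \<le> v"
proof -
  from assms obtain r where "v = length rs + i * k + r" "r < k"
    unfolding slot_def set_upt atLeastLessThan_iff
    by (metis add.commute less_add_eq_less le_Suc_ex nat_add_left_cancel_less)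
  then show "(v - length rs) div k = i" "(v - length rs) mod k = v - length rs - i * k"
    "0 < k" "length rs \<le> v"
    by (simp_all add: div_add1_eq)
qed

text \<open>Any tuples can be written into the blocks in \<open>A\<close> without disturbing the other variables,
  because the slots are disjoint.\<close>

lemma env_override:
  assumes e: "e \<in> envs S" and \<sigma>: "\<sigma> \<in> assignments S"
  shows "\<exists>e'\<in>envs S. (\<forall>v. v \<notin> (\<Union>i\<in>A. set (slot i)) \<longrightarrow> e' v = e v) \<and>
    blocks e' = (\<lambda>i. if i \<in> A then \<sigma> i else blocks e i)"
proof -
  define V where "V = (\<Union>i\<in>A. set (slot i))"
  define K where "K = length rs"
  define e' where "e' v = (if v \<in> V then \<sigma> ((v - K) div k) ! ((v - K) mod k) else e v)" for v
  have "e' v \<in> univ S" for v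
  proof (cases "v \<in> V")
    case True
    then have "0 < k" using slot_index(3) by (auto simp: V_def)
    then have "(v - K) mod k < k" by simp
    then have "(v - K) mod k < length (\<sigma> ((v - K) div k))"
      using \<sigma> by (simp add: assignments_def tuples_def)
    then have "e' v \<in> set (\<sigma> ((v - K) div k))" using True by (simp add: e'_def)
    then show ?thesis using \<sigma> by (auto simp: assignments_def tuples_def)
  qed (use e in \<open>auto simp: e'_def envs_def\<close>)
  moreover have "e' i = rs ! i" if "i < length rs" for i
  proof -
    have "i \<notin> V" using slot_index(4) that by (fastforce simp: V_def)
    then show ?thesis using e that by (simp add: e'_def envs_def)
  qed
  ultimately have "e' \<in> envs S" by (auto simp: envs_def)
  moreover have "blocks e' i = \<sigma> i" if "i \<in> A" for i
  proof (rule nth_equalityI)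
    have len: "length (\<sigma> i) = k" using \<sigma> by (simp add: assignments_def tuples_def)
    show "length (blocks e' i) = length (\<sigma> i)" by (simp add: len blocks_def slot_def)
    fix l assume "l < length (blocks e' i)"
    then have l: "l < k" by (simp add: blocks_def slot_def)
    then have in_slot: "K + i * k + l \<in> set (slot i)" by (simp add: slot_def K_def)
    then have "K + i * k + l \<in> V" using that by (auto simp: V_def)
    then show "blocks e' i ! l = \<sigma> i ! l"
      using l slot_index(1,2)[OF in_slot] by (simp add: blocks_def slot_def e'_def flip: K_def)
  qed
  moreover have "blocks e' i = blocks e i" if "i \<notin> A" for i
  proof -
    have "v \<notin> V" if "v \<in> set (slot i)" for v
      using slot_index(1)[OF that] slot_index(1) \<open>i \<notin> A\<close> unfolding V_def by blast
    then show ?thesis by (simp add: blocks_def e'_def)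
  qed
  moreover have "\<forall>v. v \<notin> V \<longrightarrow> e' v = e v" by (simp add: e'_def)
  ultimately show ?thesis unfolding V_def[symmetric] by (intro bexI[of _ e']) auto
qed

lemma assignment_blocks:
  assumes "S \<in> {M, N}" "\<rho> \<in> assignments S"
  shows "\<exists>e\<in>envs S. blocks e = \<rho>"
proof -
  obtain d where d: "d \<in> univ M" using univ_facts by blast
  have "(\<lambda>v. if v < length rs then rs ! v else d) \<in> envs S"
    using d params assms(1) univ_facts by (auto simp: envs_def subset_iff)
  from env_override[OF this assms(2), of UNIV] show ?thesis by auto
qed

lemma uniform_cong:
  assumes "uniform P"
    and "\<And>S \<rho>. S \<in> {M, N} \<Longrightarrow> \<rho> \<in> assignments S \<Longrightarrow> P S \<rho> \<longleftrightarrow> Q S \<rho>"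
  shows "uniform Q"
  using assms blocks_assignment unfolding uniform_def by (metis (no_types, lifting))

lemma uniform_not: "uniform P \<Longrightarrow> uniform (\<lambda>S \<rho>. \<not> P S \<rho>)"
  unfolding uniform_def by (metis (no_types, lifting) sat.simps(3) wf_form.simps(3))

lemma uniform_conj: "uniform P \<Longrightarrow> uniform Q \<Longrightarrow> uniform (\<lambda>S \<rho>. P S \<rho> \<and> Q S \<rho>)"
  unfolding uniform_def by (metis (no_types, lifting) sat.simps(4) wf_form.simps(4))

lemma uniform_ball:
  assumes "finite A" "\<And>x. x \<in> A \<Longrightarrow> uniform (P x)"
  shows "uniform (\<lambda>S \<rho>. \<forall>x\<in>A. P x S \<rho>)"
  using assms
proof (induction A rule: finite_induct)
  case empty
  have "uniform (\<lambda>S \<rho>. True)"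
    unfolding uniform_def by (intro exI[of _ "Eql (Var 0) (Var 0)"]) simp
  then show ?case by simp
next
  case (insert x A)
  then have "uniform (\<lambda>S \<rho>. P x S \<rho> \<and> (\<forall>x\<in>A. P x S \<rho>))" by (intro uniform_conj) auto
  then show ?case by simp
qed

lemma uniform_ex:
  assumes "finite A" "uniform P"
  shows "uniform (\<lambda>S \<rho>. \<exists>\<sigma>\<in>assignments S. (\<forall>i. i \<notin> A \<longrightarrow> \<sigma> i = \<rho> i) \<and> P S \<sigma>)"
proof -
  define V where "V = (\<Union>i\<in>A. set (slot i))"
  obtain \<phi> where \<phi>: "wf_form L \<phi>" "\<And>S e. S \<in> {M, N} \<Longrightarrow> e \<in> envs S \<Longrightarrow> sat S e \<phi> \<longleftrightarrow> P S (blocks e)"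
    using assms(2) unfolding uniform_def by blast
  have "finite V" using assms(1) by (simp add: V_def)
  with \<phi>(1) obtain \<psi> where \<psi>: "wf_form L \<psi>"
    "\<And>S :: ('f, 'p, 'a) fo_struct. \<And>e. range e \<subseteq> univ S \<Longrightarrow>
      sat S e \<psi> \<longleftrightarrow> (\<exists>e'. range e' \<subseteq> univ S \<and> (\<forall>v. v \<notin> V \<longrightarrow> e' v = e v) \<and> sat S e' \<phi>)"
    using finite_exists[where L = L and \<phi> = \<phi> and V = V and ?'a = 'a]
    by (elim meta_impE exE conjE) (assumption | rule that | simp)+
  have V_ge: "i \<notin> V" if "i < length rs" for i
    using that by (auto simp: V_def slot_def)
  have "sat S e \<psi> \<longleftrightarrow> (\<exists>\<sigma>\<in>assignments S. (\<forall>i. i \<notin> A \<longrightarrow> \<sigma> i = blocks e i) \<and> P S \<sigma>)"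
    if S: "S \<in> {M, N}" and e: "e \<in> envs S" for S e
  proof
    assume "sat S e \<psi>"
    then obtain e' where e': "range e' \<subseteq> univ S" "\<forall>v. v \<notin> V \<longrightarrow> e' v = e v" "sat S e' \<phi>"
      using \<psi>(2) e by (auto simp: envs_def)
    then have "e' \<in> envs S" using V_ge e by (auto simp: envs_def)
    moreover have "blocks e' i = blocks e i" if "i \<notin> A" for i
    proof -
      have "v \<notin> V" if "v \<in> set (slot i)" for v
        using slot_index(1)[OF that] slot_index(1) \<open>i \<notin> A\<close> unfolding V_def by blast
      then show ?thesis using e'(2) by (simp add: blocks_def)
    qed
    ultimately show "\<exists>\<sigma>\<in>assignments S. (\<forall>i. i \<notin> A \<longrightarrow> \<sigma> i = blocks e i) \<and> P S \<sigma>"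
      using e'(3) \<phi>(2)[OF S] blocks_assignment by blast
  next
    assume "\<exists>\<sigma>\<in>assignments S. (\<forall>i. i \<notin> A \<longrightarrow> \<sigma> i = blocks e i) \<and> P S \<sigma>"
    then obtain \<sigma> where \<sigma>: "\<sigma> \<in> assignments S" "\<forall>i. i \<notin> A \<longrightarrow> \<sigma> i = blocks e i" "P S \<sigma>" by blast
    from env_override[OF e \<sigma>(1), of A] obtain e' where e': "e' \<in> envs S"
      "\<forall>v. v \<notin> V \<longrightarrow> e' v = e v" "blocks e' = (\<lambda>i. if i \<in> A then \<sigma> i else blocks e i)"
      by (auto simp: V_def)
    then have "blocks e' = \<sigma>" using \<sigma>(2) by auto
    then have "sat S e' \<phi>" using \<phi>(2)[OF S e'(1)] \<sigma>(3) by simp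
    then show "sat S e \<psi>" using \<psi>(2) e e' by (auto simp: envs_def)
  qed
  then show ?thesis using \<psi>(1) unfolding uniform_def by blast
qed

text \<open>The formula \<open>\<phi>\<close> expects its arguments in the variables from \<open>0\<close> on and its parameters right
  after them. The list \<open>vs\<close> in the proof says where these values are found in an environment, and \<open>\<phi>\<close> is
  rewritten along it. Since \<open>js\<close> may have repetitions, this is not an injective renaming.\<close>

lemma uniform_realizations:
  assumes \<phi>: "param_form L M n \<phi> qs" and qs: "set qs \<subseteq> set rs" and n: "n = length js * k"
  shows "uniform (\<lambda>S \<rho>. concat (map \<rho> js) \<in> realizations S n \<phi> qs)"
proof -
  from qs have "\<forall>q\<in>set qs. \<exists>i<length rs. rs ! i = q" by (auto simp: in_set_conv_nth subset_iff)
  then obtain p where p: "\<And>q. q \<in> set qs \<Longrightarrow> p q < length rs \<and> rs ! p q = q" by metis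
  define vs where "vs = concat (map slot js) @ map p qs"
  have len: "length (concat (map slot js)) = n" unfolding n by (induction js) (auto simp: slot_def)
  have map_vs: "map e vs = concat (map (blocks e) js) @ qs" if "e \<in> envs S" for e S
  proof -
    have "map e (concat (map slot js)) = concat (map (blocks e) js)"
      by (induction js) (simp_all add: blocks_def)
    moreover have "map e (map p qs) = qs" using that p by (auto simp: envs_def intro!: map_idI)
    ultimately show ?thesis by (simp add: vs_def)
  qed
  have "sat S e (ren (nth vs) \<phi>) \<longleftrightarrow> concat (map (blocks e) js) \<in> realizations S n \<phi> qs"
    if e: "e \<in> envs S" for e S
  proof -
    have "sat S (e \<circ> nth vs) \<phi> \<longleftrightarrow> sat S (nth (concat (map (blocks e) js) @ qs)) \<phi>"
    proof (rule sat_cong)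
      fix i assume "i \<in> fv \<phi>"
      then have "i < length vs" using \<phi> len by (auto simp: param_form_def vs_def)
      then show "(e \<circ> nth vs) i = (concat (map (blocks e) js) @ qs) ! i"
        by (simp flip: map_vs[OF e])
    qed
    moreover have "length (concat (map (blocks e) js)) = n"
      using arg_cong[OF map_vs[OF e], of length] len by (simp add: vs_def)
    moreover have "set (concat (map (blocks e) js)) \<subseteq> univ S"
      using blocks_assignment[OF e] by (auto simp: assignments_def tuples_def)
    ultimately show ?thesis by (simp add: sat_ren realizations_def)
  qed
  moreover have "wf_form L (ren (nth vs) \<phi>)" using \<phi> by (simp add: wf_ren param_form_def)
  ultimately show ?thesis unfolding uniform_def by blast
qed

lemma uniform_eq: "uniform (\<lambda>S \<rho>. \<rho> i = \<rho> j)"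
proof -
  have "uniform (\<lambda>S \<rho>. \<forall>l\<in>{..<k}. \<rho> i ! l = \<rho> j ! l)"
  proof (rule uniform_ball)
    fix l assume "l \<in> {..<k}"
    then show "uniform (\<lambda>S \<rho>. \<rho> i ! l = \<rho> j ! l)"
      unfolding uniform_def
      by (intro exI[of _ "Eql (Var (slot i ! l)) (Var (slot j ! l))"])
        (simp add: blocks_def slot_def)
  qed simp
  then show ?thesis
    by (rule uniform_cong) (auto simp: assignments_def tuples_def intro: nth_equalityI)
qed

lemma uniform_transfer:
  assumes "uniform P" "\<rho> \<in> assignments M"
  shows "P M \<rho> \<longleftrightarrow> P N \<rho>"
proof -
  obtain e where e: "e \<in> envs M" "blocks e = \<rho>" using assignment_blocks assms(2) by blast
  moreover have "e \<in> envs N" using e univ_facts by (auto simp: envs_def)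
  moreover have "sat M e \<phi> \<longleftrightarrow> sat N e \<phi>" if "wf_form L \<phi>" for \<phi>
    using elem that e(1) by (auto simp: elem_substruct_def envs_def)
  ultimately show ?thesis using assms(1) unfolding uniform_def by blast
qed

text \<open>The form in which saturation is used: every sequence of \<open>k\<close>-tuples of \<open>N\<close> has a counterpart in
  \<open>M\<close> that no uniform predicate can tell from it. The parameters are among the values that are kept, so the predicates
  may depend on them.\<close>

lemma uniform_saturated:
  assumes "aleph0_saturated L M" "\<rho> \<in> assignments N"
  shows "\<exists>\<rho>'\<in>assignments M. \<forall>P. uniform P \<longrightarrow> (P M \<rho>' \<longleftrightarrow> P N \<rho>)"
proof -
  obtain c where c: "c \<in> envs N" "blocks c = \<rho>" using assignment_blocks assms(2) by blast
  obtain b where b: "range b \<subseteq> univ M" "\<forall>i<length rs. b i = c i" "same_type L M N UNIV b c"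
    using saturated_realizes_sequence[OF elem assms(1), of c "length rs"] c params
    by (auto simp: envs_def subset_iff)
  then have "b \<in> envs M" using c(1) by (auto simp: envs_def)
  then have "P M (blocks b) \<longleftrightarrow> P N \<rho>" if "uniform P" for P
    using that b(3) c unfolding uniform_def same_type_def by blast
  then show ?thesis using blocks_assignment \<open>b \<in> envs M\<close> by blast
qed

lemma uniform_ex_block:
  assumes "uniform P"
  shows "uniform (\<lambda>S \<rho>. \<exists>x\<in>tuples S. P S (\<rho>(i := x)))"
proof (rule uniform_cong[OF uniform_ex[of "{i}", OF _ assms]])
  fix S \<rho> assume \<rho>: "\<rho> \<in> assignments S"
  show "(\<exists>\<sigma>\<in>assignments S. (\<forall>j. j \<notin> {i} \<longrightarrow> \<sigma> j = \<rho> j) \<and> P S \<sigma>) \<longleftrightarrow>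
    (\<exists>x\<in>tuples S. P S (\<rho>(i := x)))"
  proof
    assume "\<exists>\<sigma>\<in>assignments S. (\<forall>j. j \<notin> {i} \<longrightarrow> \<sigma> j = \<rho> j) \<and> P S \<sigma>"
    then obtain \<sigma> where \<sigma>: "\<sigma> \<in> assignments S" "\<forall>j. j \<noteq> i \<longrightarrow> \<sigma> j = \<rho> j" "P S \<sigma>" by auto
    then have "\<rho>(i := \<sigma> i) = \<sigma>" by auto
    then show "\<exists>x\<in>tuples S. P S (\<rho>(i := x))" using \<sigma> by (auto simp: assignments_def intro!: bexI[of _ "\<sigma> i"])
  next
    assume "\<exists>x\<in>tuples S. P S (\<rho>(i := x))"
    then obtain x where "x \<in> tuples S" "P S (\<rho>(i := x))" by blast
    with \<rho> show "\<exists>\<sigma>\<in>assignments S. (\<forall>j. j \<notin> {i} \<longrightarrow> \<sigma> j = \<rho> j) \<and> P S \<sigma>"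
      by (intro bexI[of _ "\<rho>(i := x)"]) (auto simp: assignments_def)
  qed
qed simp

end

section \<open>The group and its J-sets in both structures\<close>

locale definable_group_pair = elementary_pair L M N k rs
  for L :: "('f, 'p) lang" and M N :: "('f, 'p, 'a) fo_struct" and k :: nat and rs :: "'a list" +
  fixes \<gamma> \<mu> \<xi> :: "('f, 'p) form" and ps qs :: "'a list"
  assumes group_M: "definable_group L M k \<gamma> \<mu> ps"
    and \<xi>: "param_form L M k \<xi> qs"
    and X_subset_M: "realizations M k \<xi> qs \<subseteq> carrier (group_points M k \<gamma> \<mu> ps)"
    and ps: "set ps \<subseteq> set rs" and qs: "set qs \<subseteq> set rs"
begin

definition G :: "('f, 'p, 'a) fo_struct \<Rightarrow> 'a list monoid" where
  "G S = group_points S k \<gamma> \<mu> ps"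

definition X :: "('f, 'p, 'a) fo_struct \<Rightarrow> 'a list set" where
  "X S = realizations S k \<xi> qs"

definition graph :: "('f, 'p, 'a) fo_struct \<Rightarrow> 'a list \<Rightarrow> 'a list \<Rightarrow> 'a list \<Rightarrow> bool" where
  "graph S x y z \<longleftrightarrow> x @ y @ z \<in> realizations S (3 * k) \<mu> ps"

lemma carrier_G: "carrier (G S) = realizations S k \<gamma> ps"
  by (simp add: G_def group_points_def)

lemma mult_G: "x \<otimes>\<^bsub>G S\<^esub> y = (THE z. graph S x y z)"
  by (simp add: G_def group_points_def graph_def)

lemma carrier_tuples: "carrier (G S) \<subseteq> tuples S"
  by (auto simp: carrier_G realizations_def tuples_def)

lemma X_tuples: "X S \<subseteq> tuples S"
  by (auto simp: X_def realizations_def tuples_def)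

lemma uniform_carrier: "uniform (\<lambda>S \<rho>. \<rho> i \<in> carrier (G S))"
  using uniform_realizations[of k \<gamma> ps "[i]"] group_M ps
  by (simp add: definable_group_def carrier_G)

lemma uniform_X: "uniform (\<lambda>S \<rho>. \<rho> i \<in> X S)"
  using uniform_realizations[of k \<xi> qs "[i]"] \<xi> qs by (simp add: X_def)

lemma uniform_graph: "uniform (\<lambda>S \<rho>. graph S (\<rho> i) (\<rho> j) (\<rho> l))"
proof -
  have "uniform (\<lambda>S \<rho>. concat (map \<rho> [i, j, l]) \<in> realizations S (3 * k) \<mu> ps)"
    by (rule uniform_realizations) (use group_M ps in \<open>auto simp: definable_group_def\<close>)
  then show ?thesis by (simp add: graph_def)
qed

lemma tuples_nonempty: "S \<in> {M, N} \<Longrightarrow> \<exists>x. x \<in> tuples S"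
proof -
  assume S: "S \<in> {M, N}"
  obtain d where "d \<in> univ M" using univ_facts by blast
  then have "replicate k d \<in> tuples S" using S univ_facts by (auto simp: tuples_def)
  then show ?thesis by blast
qed

lemma graph_tuples: "graph S x y z \<Longrightarrow> x \<in> tuples S \<Longrightarrow> y \<in> tuples S \<Longrightarrow> z \<in> tuples S"
  by (auto simp: graph_def realizations_def tuples_def)

text \<open>The negation of the claim, existentially closed, is a uniform sentence. It fails in \<open>M\<close>, where
  \<open>\<mu>\<close> defines a group operation, hence it fails in \<open>N\<close>.\<close>

lemma graph_functional:
  assumes "S \<in> {M, N}" "x \<in> carrier (G S)" "y \<in> carrier (G S)"
  shows "\<exists>z\<in>carrier (G S). graph S x y z \<and> (\<forall>w\<in>tuples S. graph S x y w \<longrightarrow> w = z)"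
proof -
  define bad where "bad S \<longleftrightarrow> (\<exists>x\<in>tuples S. \<exists>y\<in>tuples S.
      (x \<in> carrier (G S) \<and> y \<in> carrier (G S)) \<and>
      \<not> (\<exists>z\<in>tuples S. (z \<in> carrier (G S) \<and> graph S x y z) \<and>
           \<not> (\<exists>w\<in>tuples S. graph S x y w \<and> w \<noteq> z)))" for S
  have "uniform (\<lambda>S \<rho>. \<exists>w\<in>tuples S. graph S (\<rho> 0) (\<rho> 1) w \<and> w \<noteq> \<rho> 2)"
    using uniform_ex_block[OF uniform_conj[OF uniform_graph[of 0 1 3] uniform_not[OF uniform_eq[of 3 2]]], of 3]
    by simp
  from uniform_ex_block[OF uniform_conj[OF
      uniform_conj[OF uniform_carrier[of 2] uniform_graph[of 0 1 2]] uniform_not[OF this]], of 2]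
  have "uniform (\<lambda>S \<rho>. \<exists>z\<in>tuples S. (z \<in> carrier (G S) \<and> graph S (\<rho> 0) (\<rho> 1) z) \<and>
           \<not> (\<exists>w\<in>tuples S. graph S (\<rho> 0) (\<rho> 1) w \<and> w \<noteq> z))"
    by simp
  from uniform_ex_block[OF uniform_conj[OF
      uniform_conj[OF uniform_carrier[of 0] uniform_carrier[of 1]] uniform_not[OF this]], of 1]
  have "uniform (\<lambda>S \<rho>. \<exists>y\<in>tuples S.
      (\<rho> 0 \<in> carrier (G S) \<and> y \<in> carrier (G S)) \<and>
      \<not> (\<exists>z\<in>tuples S. (z \<in> carrier (G S) \<and> graph S (\<rho> 0) y z) \<and>
           \<not> (\<exists>w\<in>tuples S. graph S (\<rho> 0) y w \<and> w \<noteq> z)))"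
    by simp
  from uniform_ex_block[OF this, of 0] have "uniform (\<lambda>S \<rho>. bad S)"
    by (simp add: bad_def)
  moreover obtain x0 where "x0 \<in> tuples M" using tuples_nonempty by blast
  then have "(\<lambda>_. x0) \<in> assignments M" by (simp add: assignments_def)
  ultimately have "bad M \<longleftrightarrow> bad N" by (rule uniform_transfer)
  moreover have "\<not> bad M"
  proof -
    interpret group "G M" using group_M by (simp add: definable_group_def G_def)
    have mult: "graph M x y z \<longleftrightarrow> z = x \<otimes>\<^bsub>G M\<^esub> y"
      if x: "x \<in> carrier (G M)" and y: "y \<in> carrier (G M)" for x y z
    proof -
      have "length u = k" if "u \<in> carrier (G M)" for u
        using that carrier_tuples by (auto simp: tuples_def)
      then show ?thesis
        using group_M x y unfolding definable_group_def graph_def by (fold G_def) fastforce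
    qed
    have "\<exists>z\<in>tuples M. (z \<in> carrier (G M) \<and> graph M x y z) \<and>
        \<not> (\<exists>w\<in>tuples M. graph M x y w \<and> w \<noteq> z)"
      if "x \<in> carrier (G M)" "y \<in> carrier (G M)" for x y
    proof (intro bexI[of _ "x \<otimes>\<^bsub>G M\<^esub> y"] conjI)
      show "x \<otimes>\<^bsub>G M\<^esub> y \<in> carrier (G M)" using that by (rule m_closed)
      then show "x \<otimes>\<^bsub>G M\<^esub> y \<in> tuples M" using carrier_tuples by blast
    qed (simp_all add: mult[OF that])
    then show ?thesis unfolding bad_def by blast
  qed
  ultimately have "\<not> bad S" using assms(1) by auto
  then have "\<exists>z\<in>tuples S. (z \<in> carrier (G S) \<and> graph S x y z) \<and>
      \<not> (\<exists>w\<in>tuples S. graph S x y w \<and> w \<noteq> z)"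
    using assms(2,3) carrier_tuples[of S] unfolding bad_def by (meson subsetD)
  then show ?thesis by blast
qed

lemma graph_iff_mult:
  assumes "S \<in> {M, N}" "x \<in> carrier (G S)" "y \<in> carrier (G S)"
  shows "graph S x y z \<longleftrightarrow> z = x \<otimes>\<^bsub>G S\<^esub> y" and "x \<otimes>\<^bsub>G S\<^esub> y \<in> carrier (G S)"
proof -
  from graph_functional[OF assms] obtain z0 where z0: "z0 \<in> carrier (G S)" "graph S x y z0"
    "\<And>w. w \<in> tuples S \<Longrightarrow> graph S x y w \<Longrightarrow> w = z0" by blast
  have uniq: "w = z0" if "graph S x y w" for w
    using z0(3) graph_tuples that assms carrier_tuples by blast
  then have mult: "x \<otimes>\<^bsub>G S\<^esub> y = z0" unfolding mult_G using z0(2) by blast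
  show "graph S x y z \<longleftrightarrow> z = x \<otimes>\<^bsub>G S\<^esub> y" unfolding mult using z0(2) uniq by blast
  show "x \<otimes>\<^bsub>G S\<^esub> y \<in> carrier (G S)" unfolding mult by (rule z0(1))
qed

lemma X_subset:
  assumes "S \<in> {M, N}"
  shows "X S \<subseteq> carrier (G S)"
proof -
  from uniform_ex_block[OF uniform_conj[OF uniform_X[of 0] uniform_not[OF uniform_carrier[of 0]]], of 0]
  have "uniform (\<lambda>S \<rho>. \<exists>x\<in>tuples S. x \<in> X S \<and> x \<notin> carrier (G S))" by simp
  moreover obtain x0 where "x0 \<in> tuples M" using tuples_nonempty by blast
  then have "(\<lambda>_. x0) \<in> assignments M" by (simp add: assignments_def)
  ultimately have "(\<exists>x\<in>tuples M. x \<in> X M \<and> x \<notin> carrier (G M)) \<longleftrightarrow>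
      (\<exists>x\<in>tuples N. x \<in> X N \<and> x \<notin> carrier (G N))"
    by (rule uniform_transfer)
  then show ?thesis using assms X_subset_M X_tuples unfolding G_def X_def by blast
qed

text \<open>The values \<open>\<chi>(m, a, t, f)\<close> are products over a list of block indices. The factors are required to
  lie in the group, because outside of it the multiplication is not described by its graph.\<close>

definition product_in_X :: "nat \<Rightarrow> nat list \<Rightarrow> ('f, 'p, 'a) fo_struct \<Rightarrow> (nat \<Rightarrow> 'a list) \<Rightarrow> bool" where
  "product_in_X i js S \<rho> \<longleftrightarrow> (\<forall>j\<in>set (i # js). \<rho> j \<in> carrier (G S)) \<and>
     foldl (\<lambda>g j. g \<otimes>\<^bsub>G S\<^esub> \<rho> j) (\<rho> i) js \<in> X S"

text \<open>The first two factors are multiplied into a fresh block \<open>u\<close>, whose value is described by the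
  graph of the multiplication. What remains is a shorter product that starts with \<open>u\<close>.\<close>

lemma uniform_product_in_X: "uniform (product_in_X i js)"
proof (induction js arbitrary: i)
  case Nil
  from uniform_conj[OF uniform_carrier[of i] uniform_X[of i]] show ?case
    by (simp add: product_in_X_def[abs_def])
next
  case (Cons j js)
  obtain u where u: "u \<notin> set (i # j # js)"
    using ex_new_if_finite[of "set (i # j # js)"] by auto
  from uniform_conj[OF uniform_conj[OF uniform_carrier[of i] uniform_carrier[of j]]
      uniform_ex_block[OF uniform_conj[OF uniform_graph[of i j u] Cons.IH[of u]], of u]]
  show ?case
  proof (rule uniform_cong)
    fix S \<rho> assume S: "S \<in> {M, N}"
    have upd: "product_in_X u js S (\<rho>(u := x)) \<longleftrightarrow> x \<in> carrier (G S) \<and>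
        (\<forall>l\<in>set js. \<rho> l \<in> carrier (G S)) \<and> foldl (\<lambda>g l. g \<otimes>\<^bsub>G S\<^esub> \<rho> l) x js \<in> X S" for x
    proof -
      have "foldl (\<lambda>g l. g \<otimes>\<^bsub>G S\<^esub> (\<rho>(u := x)) l) x js = foldl (\<lambda>g l. g \<otimes>\<^bsub>G S\<^esub> \<rho> l) x js"
        by (rule foldl_cong) (use u in auto)
      moreover have "(\<rho>(u := x)) l = \<rho> l" if "l \<in> set js" for l using u that by auto
      ultimately show ?thesis by (simp add: product_in_X_def)
    qed
    show "((\<rho> i \<in> carrier (G S) \<and> \<rho> j \<in> carrier (G S)) \<and>
        (\<exists>x\<in>tuples S. graph S ((\<rho>(u := x)) i) ((\<rho>(u := x)) j) ((\<rho>(u := x)) u) \<and>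
          product_in_X u js S (\<rho>(u := x)))) \<longleftrightarrow> product_in_X i (j # js) S \<rho>"
    proof (cases "\<rho> i \<in> carrier (G S) \<and> \<rho> j \<in> carrier (G S)")
      case True
      then have "graph S (\<rho> i) (\<rho> j) z \<longleftrightarrow> z = \<rho> i \<otimes>\<^bsub>G S\<^esub> \<rho> j"
        "\<rho> i \<otimes>\<^bsub>G S\<^esub> \<rho> j \<in> carrier (G S)" for z
        using graph_iff_mult[OF S] by auto
      moreover from this(2) have "\<rho> i \<otimes>\<^bsub>G S\<^esub> \<rho> j \<in> tuples S" using carrier_tuples by blast
      ultimately show ?thesis using True u unfolding upd by (auto simp: product_in_X_def)
    next
      case False
      moreover from this have "\<not> product_in_X i (j # js) S \<rho>" unfolding product_in_X_def by auto
      ultimately show ?thesis by blast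
    qed
  qed
qed

text \<open>The tuples \<open>a(i)\<close> and \<open>f\<^sub>j(n)\<close> are kept in pairwise different blocks.\<close>

definition coeff_block :: "nat \<Rightarrow> nat" where
  "coeff_block i = sum_encode (Inl i)"

definition seq_block :: "nat \<Rightarrow> nat \<Rightarrow> nat" where
  "seq_block j n = sum_encode (Inr (prod_encode (j, n)))"

lemma block_simps [simp]:
  "coeff_block i = coeff_block i' \<longleftrightarrow> i = i'"
  "seq_block j n = seq_block j' n' \<longleftrightarrow> j = j' \<and> n = n'"
  "coeff_block i \<noteq> seq_block j n" "seq_block j n \<noteq> coeff_block i"
  by (simp_all add: coeff_block_def seq_block_def sum_encode_eq prod_encode_eq)

definition chi_word :: "nat \<Rightarrow> (nat \<Rightarrow> nat) \<Rightarrow> nat \<Rightarrow> nat list" where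
  "chi_word m t j = concat (map (\<lambda>i. [seq_block j (t i), coeff_block (i + 1)]) [1..<m + 1])"

lemma chi_word_Suc:
  "chi_word (Suc m) t j = chi_word m t j @ [seq_block j (t (m + 1)), coeff_block (m + 2)]"
  by (simp add: chi_word_def)

lemma chi_eq_foldl:
  assumes "\<And>i. i \<in> {1..m + 1} \<Longrightarrow> \<rho> (coeff_block i) = a i"
    and "\<And>i. i \<in> {1..m} \<Longrightarrow> \<rho> (seq_block j (t i)) = f (t i)"
  shows "chi H m a t f = foldl (\<lambda>g l. g \<otimes>\<^bsub>H\<^esub> \<rho> l) (\<rho> (coeff_block 1)) (chi_word m t j)"
  using assms
proof (induction m)
  case 0
  then show ?case by (simp add: chi_word_def)
next
  case (Suc m)
  have "chi H m a t f = foldl (\<lambda>g l. g \<otimes>\<^bsub>H\<^esub> \<rho> l) (\<rho> (coeff_block 1)) (chi_word m t j)"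
    by (rule Suc.IH) (use Suc.prems in auto)
  moreover have "\<rho> (coeff_block (m + 2)) = a (m + 2)" "\<rho> (seq_block j (t (m + 1))) = f (t (m + 1))"
    using Suc.prems by auto
  ultimately show ?case by (simp add: chi_word_Suc)
qed

lemma set_chi_word:
  "set (chi_word m t j) = seq_block j ` t ` {1..m} \<union> coeff_block ` {2..m + 1}"
proof (induction m)
  case (Suc m)
  have "set (chi_word (Suc m) t j) =
      insert (seq_block j (t (Suc m))) (insert (coeff_block (m + 2)) (set (chi_word m t j)))"
    by (auto simp: chi_word_Suc)
  also have "\<dots> = seq_block j ` t ` {1..Suc m} \<union> coeff_block ` {2..Suc m + 1}"
    unfolding Suc.IH by (auto simp: atLeastAtMostSuc_conv)
  finally show ?case .
qed (simp add: chi_word_def)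

text \<open>This is the formula \<open>\<theta>\<^sub>m\<^sub>,\<^sub>t\<close> of the introduction for \<open>r\<close> sequences. That the coefficients lie in
  the group is a separate conjunct, because for \<open>r = 0\<close> the products say nothing about them.\<close>

definition solvable :: "nat \<Rightarrow> nat \<Rightarrow> (nat \<Rightarrow> nat) \<Rightarrow> ('f, 'p, 'a) fo_struct \<Rightarrow> (nat \<Rightarrow> 'a list) \<Rightarrow> bool" where
  "solvable r m t S \<rho> \<longleftrightarrow> (\<exists>\<sigma>\<in>assignments S.
     (\<forall>l. l \<notin> coeff_block ` {1..m + 1} \<longrightarrow> \<sigma> l = \<rho> l) \<and>
     (\<forall>i\<in>{1..m + 1}. \<sigma> (coeff_block i) \<in> carrier (G S)) \<and>
     (\<forall>j\<in>{..<r}. product_in_X (coeff_block 1) (chi_word m t j) S \<sigma>))"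

lemma uniform_solvable: "uniform (solvable r m t)"
proof -
  have "uniform (\<lambda>S \<sigma>. (\<forall>i\<in>{1..m + 1}. \<sigma> (coeff_block i) \<in> carrier (G S)) \<and>
     (\<forall>j\<in>{..<r}. product_in_X (coeff_block 1) (chi_word m t j) S \<sigma>))"
    by (intro uniform_conj uniform_ball uniform_carrier uniform_product_in_X) auto
  from uniform_ex[OF _ this, of "coeff_block ` {1..m + 1}"] show ?thesis
    by (simp add: solvable_def[abs_def])
qed

lemma solvable_iff_chi:
  assumes S: "S \<in> {M, N}" and \<rho>: "\<rho> \<in> assignments S" and t: "t \<in> incr_seqs m"
    and f: "\<And>j n. j < r \<Longrightarrow> 1 \<le> n \<Longrightarrow> \<rho> (seq_block j n) = f j n \<and> f j n \<in> carrier (G S)"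
  shows "solvable r m t S \<rho> \<longleftrightarrow>
    (\<exists>a \<in> {1..m + 1} \<rightarrow>\<^sub>E carrier (G S). \<forall>j<r. chi (G S) m a t (f j) \<in> X S)"
proof -
  have "t \<in> {1..m} \<rightarrow> {1..}" using t by (simp add: incr_seqs_def PiE_def)
  then have t1: "1 \<le> t i" if "i \<in> {1..m}" for i using that by (simp add: Pi_iff)
  show ?thesis
  proof
    assume "solvable r m t S \<rho>"
    then obtain \<sigma> where \<sigma>: "\<And>l. l \<notin> coeff_block ` {1..m + 1} \<Longrightarrow> \<sigma> l = \<rho> l"
      "\<And>i. i \<in> {1..m + 1} \<Longrightarrow> \<sigma> (coeff_block i) \<in> carrier (G S)"
      "\<And>j. j < r \<Longrightarrow> product_in_X (coeff_block 1) (chi_word m t j) S \<sigma>"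
      unfolding solvable_def by blast
    define a where "a = (\<lambda>i\<in>{1..m + 1}. \<sigma> (coeff_block i))"
    have "chi (G S) m a t (f j) \<in> X S" if "j < r" for j
    proof -
      have "chi (G S) m a t (f j) =
          foldl (\<lambda>g l. g \<otimes>\<^bsub>G S\<^esub> \<sigma> l) (\<sigma> (coeff_block 1)) (chi_word m t j)"
      proof (rule chi_eq_foldl)
        fix i assume i: "i \<in> {1..m}"
        have "seq_block j (t i) \<notin> coeff_block ` {1..m + 1}" by auto
        then show "\<sigma> (seq_block j (t i)) = f j (t i)"
          using \<sigma>(1) f[OF that t1[OF i]] by simp
      qed (simp add: a_def)
      then show ?thesis using \<sigma>(3)[OF that] by (simp add: product_in_X_def)
    qed
    moreover have "a \<in> {1..m + 1} \<rightarrow>\<^sub>E carrier (G S)" using \<sigma>(2) by (auto simp: a_def)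
    ultimately show "\<exists>a \<in> {1..m + 1} \<rightarrow>\<^sub>E carrier (G S). \<forall>j<r. chi (G S) m a t (f j) \<in> X S" by blast
  next
    assume "\<exists>a \<in> {1..m + 1} \<rightarrow>\<^sub>E carrier (G S). \<forall>j<r. chi (G S) m a t (f j) \<in> X S"
    then obtain a where a: "\<And>i. i \<in> {1..m + 1} \<Longrightarrow> a i \<in> carrier (G S)"
      "\<And>j. j < r \<Longrightarrow> chi (G S) m a t (f j) \<in> X S" by blast
    define \<sigma> where "\<sigma> l = (if l \<in> coeff_block ` {1..m + 1} then a (the_inv coeff_block l) else \<rho> l)" for l
    have decode: "the_inv coeff_block (coeff_block i) = i" for i
      by (rule the_inv_f_f) (simp add: inj_def)
    have \<sigma>a: "\<sigma> (coeff_block i) = a i" if "i \<in> {1..m + 1}" for i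
      using that by (simp add: \<sigma>_def decode)
    have \<sigma>f: "\<sigma> (seq_block j (t i)) = f j (t i)" if "j < r" "i \<in> {1..m}" for i j
      using f[OF that(1) t1[OF that(2)]] by (auto simp: \<sigma>_def)
    have "\<sigma> \<in> assignments S"
      using \<rho> a(1) carrier_tuples[of S] by (auto simp: \<sigma>_def assignments_def decode subset_iff)
    moreover have "product_in_X (coeff_block 1) (chi_word m t j) S \<sigma>" if j: "j < r" for j
    proof -
      have "chi (G S) m a t (f j) =
          foldl (\<lambda>g l. g \<otimes>\<^bsub>G S\<^esub> \<sigma> l) (\<sigma> (coeff_block 1)) (chi_word m t j)"
        by (rule chi_eq_foldl) (use \<sigma>a \<sigma>f[OF j] in auto)
      moreover have "\<sigma> l \<in> carrier (G S)" if "l \<in> set (coeff_block 1 # chi_word m t j)" for l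
      proof -
        from that consider i where "l = coeff_block i" "i \<in> {1..m + 1}"
          | i where "l = seq_block j (t i)" "i \<in> {1..m}"
          by (fastforce simp: set_chi_word)
        then show ?thesis using \<sigma>a a(1) \<sigma>f[OF j] f[OF j t1] by cases auto
      qed
      ultimately show ?thesis using a(2)[OF j] by (simp add: product_in_X_def)
    qed
    moreover have "\<sigma> (coeff_block i) \<in> carrier (G S)" if "i \<in> {1..m + 1}" for i
      using \<sigma>a a(1) that by simp
    moreover have "\<sigma> l = \<rho> l" if "l \<notin> coeff_block ` {1..m + 1}" for l
      using that by (simp add: \<sigma>_def)
    ultimately show "solvable r m t S \<rho>" unfolding solvable_def by blast
  qed
qed

text \<open>A finite set of sequences is enumerated as \<open>f\<^sub>0, \<dots>, f\<^sub>r\<^sub>-\<^sub>1\<close>, possibly with repetitions, and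
  stored in one assignment. All other blocks receive an arbitrary tuple \<open>x0\<close>.\<close>

lemma J_set_iff_solvable:
  assumes S: "S \<in> {M, N}"
  shows "J_set (G S) (X S) \<longleftrightarrow> (\<forall>r. \<forall>\<rho>\<in>assignments S.
    (\<forall>j<r. \<forall>n\<ge>1. \<rho> (seq_block j n) \<in> carrier (G S)) \<longrightarrow>
    (\<exists>m\<ge>1. \<exists>t\<in>incr_seqs m. solvable r m t S \<rho>))"
    (is "_ \<longleftrightarrow> ?R")
proof
  assume J: "J_set (G S) (X S)"
  show ?R
  proof (intro allI ballI impI)
    fix r \<rho> assume \<rho>: "\<rho> \<in> assignments S"
      and c: "\<forall>j<r. \<forall>n\<ge>1. \<rho> (seq_block j n) \<in> carrier (G S)"
    define f where "f j = (\<lambda>n\<in>{1..}. \<rho> (seq_block j n))" for j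
    have "finite (f ` {..<r})" "f ` {..<r} \<subseteq> {1..} \<rightarrow>\<^sub>E carrier (G S)"
      using c by (auto simp: f_def split: if_splits)
    with J have "\<exists>m\<ge>1. \<exists>t\<in>incr_seqs m. \<exists>a \<in> {1..m + 1} \<rightarrow>\<^sub>E carrier (G S).
        \<forall>g\<in>f ` {..<r}. chi (G S) m a t g \<in> X S"
      unfolding J_set_def by (elim conjE allE[of _ "f ` {..<r}"]) simp
    then obtain m t a where mta: "1 \<le> m" "t \<in> incr_seqs m" "a \<in> {1..m + 1} \<rightarrow>\<^sub>E carrier (G S)"
      "\<forall>g\<in>f ` {..<r}. chi (G S) m a t g \<in> X S"
      by blast
    have "solvable r m t S \<rho>"
    proof (subst solvable_iff_chi[OF S \<rho> mta(2), of r f])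
      show "\<exists>a \<in> {1..m + 1} \<rightarrow>\<^sub>E carrier (G S). \<forall>j<r. chi (G S) m a t (f j) \<in> X S"
        using mta(3,4) by blast
    qed (use c in \<open>simp add: f_def\<close>)
    with mta show "\<exists>m\<ge>1. \<exists>t\<in>incr_seqs m. solvable r m t S \<rho>" by blast
  qed
next
  assume R: ?R
  show "J_set (G S) (X S)"
    unfolding J_set_def
  proof (intro conjI allI impI X_subset[OF S])
    fix F :: "(nat \<Rightarrow> 'a list) set"
    assume F: "finite F \<and> F \<subseteq> {1..} \<rightarrow>\<^sub>E carrier (G S)"
    then obtain r :: nat and f :: "nat \<Rightarrow> nat \<Rightarrow> 'a list" where f: "F = f ` {j. j < r}"
      using finite_imp_nat_seg_image_inj_on[of F] by blast
    then have fc: "f j n \<in> carrier (G S)" if "j < r" "1 \<le> n" for j n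
      using F that by (auto simp: PiE_def Pi_def)
    obtain x0 where x0: "x0 \<in> tuples S" using tuples_nonempty[OF S] by blast
    define \<rho> where "\<rho> l = (case sum_decode l of Inl _ \<Rightarrow> x0
      | Inr q \<Rightarrow> (case prod_decode q of (j, n) \<Rightarrow> if j < r \<and> 1 \<le> n then f j n else x0))" for l
    have \<rho>: "\<rho> \<in> assignments S"
      using fc carrier_tuples[of S] x0
      by (auto simp: assignments_def \<rho>_def split: sum.split prod.split)
    have \<rho>f: "\<rho> (seq_block j n) = f j n" if "j < r" "1 \<le> n" for j n
      using that by (simp add: \<rho>_def seq_block_def)
    have "\<forall>j<r. \<forall>n\<ge>1. \<rho> (seq_block j n) \<in> carrier (G S)" using \<rho>f fc by simp
    with R \<rho> obtain m t where mt: "1 \<le> m" "t \<in> incr_seqs m" "solvable r m t S \<rho>"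
      by blast
    then have "\<exists>a \<in> {1..m + 1} \<rightarrow>\<^sub>E carrier (G S). \<forall>j<r. chi (G S) m a t (f j) \<in> X S"
      using solvable_iff_chi[OF S \<rho> mt(2), of r f] \<rho>f fc by blast
    then show "\<exists>m\<ge>1. \<exists>t\<in>incr_seqs m. \<exists>a \<in> {1..m + 1} \<rightarrow>\<^sub>E carrier (G S). \<forall>g\<in>F. chi (G S) m a t g \<in> X S"
      using mt(1,2) unfolding f by blast
  qed
qed

lemma J_set_descends:
  assumes "J_set (G N) (X N)"
  shows "J_set (G M) (X M)"
  unfolding J_set_iff_solvable[OF insertI1]
proof (intro allI ballI impI)
  fix r \<rho> assume \<rho>: "\<rho> \<in> assignments M"
    and c: "\<forall>j<r. \<forall>n\<ge>1. \<rho> (seq_block j n) \<in> carrier (G M)"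
  have "\<forall>j<r. \<forall>n\<ge>1. \<rho> (seq_block j n) \<in> carrier (G N)"
    using c uniform_transfer[OF uniform_carrier \<rho>] by blast
  with assms \<rho> assignments_mono obtain m t where "1 \<le> m" "t \<in> incr_seqs m" "solvable r m t N \<rho>"
    unfolding J_set_iff_solvable[OF insertI2[OF singletonI]] by blast
  then show "\<exists>m\<ge>1. \<exists>t\<in>incr_seqs m. solvable r m t M \<rho>"
    using uniform_transfer[OF uniform_solvable \<rho>] by blast
qed

lemma J_set_ascends:
  assumes sat: "aleph0_saturated L M" and J: "J_set (G M) (X M)"
  shows "J_set (G N) (X N)"
  unfolding J_set_iff_solvable[OF insertI2[OF singletonI]]
proof (intro allI ballI impI)
  fix r \<rho> assume \<rho>: "\<rho> \<in> assignments N"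
    and c: "\<forall>j<r. \<forall>n\<ge>1. \<rho> (seq_block j n) \<in> carrier (G N)"
  from uniform_saturated[OF sat \<rho>] obtain \<rho>' where \<rho>': "\<rho>' \<in> assignments M"
    "\<And>P. uniform P \<Longrightarrow> P M \<rho>' \<longleftrightarrow> P N \<rho>" by blast
  have "\<forall>j<r. \<forall>n\<ge>1. \<rho>' (seq_block j n) \<in> carrier (G M)"
    using c \<rho>'(2)[OF uniform_carrier] by blast
  with J \<rho>'(1) obtain m t where "1 \<le> m" "t \<in> incr_seqs m" "solvable r m t M \<rho>'"
    unfolding J_set_iff_solvable[OF insertI1] by blast
  then show "\<exists>m\<ge>1. \<exists>t\<in>incr_seqs m. solvable r m t N \<rho>"
    using \<rho>'(2)[OF uniform_solvable] by blast
qed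

end

theorem proposition2p5:
  fixes L :: "('f, 'p) lang"
    and M N :: "('f, 'p, 'a) fo_struct"
    and k :: nat
    and \<gamma> \<mu> \<xi> :: "('f, 'p) form"
    and ps qs :: "'a list"
  assumes "elem_substruct L M N"
    and "definable_group L M k \<gamma> \<mu> ps"
    and "param_form L M k \<xi> qs"
    and "realizations M k \<xi> qs \<subseteq> carrier (group_points M k \<gamma> \<mu> ps)"
  shows "(J_set (group_points N k \<gamma> \<mu> ps) (realizations N k \<xi> qs) \<longrightarrow>
            J_set (group_points M k \<gamma> \<mu> ps) (realizations M k \<xi> qs)) \<and>
         (aleph0_saturated L M \<longrightarrow>
            J_set (group_points M k \<gamma> \<mu> ps) (realizations M k \<xi> qs) \<longrightarrow>
            J_set (group_points N k \<gamma> \<mu> ps) (realizations N k \<xi> qs))"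
proof -
  interpret definable_group_pair L M N k "ps @ qs" \<gamma> \<mu> \<xi> ps qs
    using assms by unfold_locales (auto simp: definable_group_def param_form_def)
  show ?thesis using J_set_descends J_set_ascends by (simp add: G_def X_def)
qed

end
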